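(* Let $\precsim$ be a preorder on a topological space $(Y,\tau)$. If $\tau$ is finer than $\tau^{\precsim}_{U}$, then $\precsim$ admits a (lower) semi-continuous multi-utility representation; that is, there is a family $\mathcal{U}$ of isotonic functions $u:Y\to\mathbb{R}$, each of which is lower semi-continuous on $(Y,\tau)$, such that for all $x,y\in Y$: $x\precsim y$ if and only if $u(x)\le u(y)$ for all $u\in\mathcal{U}$.
   Context: A preorder is a reflexive and transitive binary relation on a non-empty set. The upper topology $\tau^{\precsim}_{U}$ is the topology on $Y$ generated by the subbase $\{Y\setminus L^{\precsim}(x)\}_{x\in Y}$, where $L^{\precsim}(x)=\{z\in Y: z\precsim x\}$. "Finer" means $\tau^{\precsim}_{U}\subseteq\tau$ (equality allowed). A function $u:Y\to\mathbb{R}$ is isotonic if $x\precsim y$ implies $u(x)\le u(y)$. A function $f:Y\to\mathbb{R}$ is lower semi-continuous if it is continuous from $(Y,\tau)$ to $\mathbb{R}$ equipped with the upper topology of the usual order $\le$ (the topology generated by the sets $(a,\infty)$, $a\in\mathbb{R}$). *)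

theory Defs
  imports "HOL-Analysis.Analysis"
begin

text \<open>A pair \<open>(x, y) \<in> R\<close> means that \<open>x\<close> is below \<open>y\<close> in the relation \<open>R\<close>.\<close>

definition lower_section :: "'a set \<Rightarrow> 'a rel \<Rightarrow> 'a \<Rightarrow> 'a set" where
  "lower_section Y R x = {z \<in> Y. (z, x) \<in> R}"

text \<open>\<open>topology_generated_by \<S>\<close> is a topology on \<open>\<Union>\<S>\<close>, whereas the topology on \<open>Y\<close> with a given
  subbase always has \<open>Y\<close> as an open set (the empty intersection). The complements of the lower
  sections need not cover \<open>Y\<close> (a least element of \<open>Y\<close> lies in none of them), so \<open>Y\<close> is inserted.\<close>

definition upper_topology :: "'a set \<Rightarrow> 'a rel \<Rightarrow> 'a topology" where
  "upper_topology Y R =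
     topology_generated_by (insert Y ((\<lambda>x. Y - lower_section Y R x) ` Y))"

lemma topspace_upper_topology [simp]: "topspace (upper_topology Y R) = Y"
  by (auto simp: upper_topology_def)

definition isotonic_on :: "'a set \<Rightarrow> 'a rel \<Rightarrow> ('a \<Rightarrow> real) \<Rightarrow> bool" where
  "isotonic_on Y R u \<longleftrightarrow> (\<forall>x\<in>Y. \<forall>y\<in>Y. (x, y) \<in> R \<longrightarrow> u x \<le> u y)"

definition lower_semicontinuous :: "'a topology \<Rightarrow> ('a \<Rightarrow> real) \<Rightarrow> bool" where
  "lower_semicontinuous \<tau> f \<longleftrightarrow>
     continuous_map \<tau> (upper_topology UNIV {(a, b). a \<le> b}) f"

text \<open>The subbase of the upper topology of the usual order on the reals consists of the rays
  \<open>{a<..}\<close>, which already cover the real line.\<close>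

lemma upper_topology_real:
  "upper_topology UNIV {(a, b). a \<le> (b::real)} = topology_generated_by (range greaterThan)"
proof -
  let ?S = "range (greaterThan :: real \<Rightarrow> real set)"
  have rays: "(\<lambda>x. UNIV - lower_section UNIV {(a, b). a \<le> (b::real)} x) ` UNIV = ?S"
    by (rule image_cong) (auto simp: lower_section_def)
  have cover: "\<Union>?S = UNIV"
    using lt_ex by auto
  have "generate_topology_on ?S (\<Union>?S)"
    by (rule generate_topology_on.UN) (auto intro: generate_topology_on.Basis)
  then have UNIV_S: "generate_topology_on ?S UNIV"
    by (simp only: cover)
  have *: "generate_topology_on ?S s" if "generate_topology_on (insert UNIV ?S) s" for s
    using that by induction (use UNIV_S in \<open>auto intro: generate_topology_on.intros\<close>)
  have **: "generate_topology_on (insert UNIV ?S) s" if "generate_topology_on ?S s" for s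
    using that by induction (auto intro: generate_topology_on.intros)
  show ?thesis
    unfolding upper_topology_def rays
    by (auto simp: topology_eq openin_topology_generated_by_iff intro: * **)
qed

definition semicontinuous_multi_utility ::
    "'a topology \<Rightarrow> 'a rel \<Rightarrow> ('a \<Rightarrow> real) set \<Rightarrow> bool" where
  "semicontinuous_multi_utility \<tau> R \<U> \<longleftrightarrow>
     (\<forall>u\<in>\<U>. isotonic_on (topspace \<tau>) R u \<and> lower_semicontinuous \<tau> u) \<and>
     (\<forall>x\<in>topspace \<tau>. \<forall>y\<in>topspace \<tau>. (x, y) \<in> R \<longleftrightarrow> (\<forall>u\<in>\<U>. u x \<le> u y))"

end

theory Submission
  imports Defs
begin

text \<open>Indicators of complements of lower sections form the family. For z in Y, the set Y -
  L(z) is subbasic for the upper topology, hence open in \<tau>, so its indicator is lower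
  semi-continuous (\<open>lower_semicontinuous_indicator\<close>); it is upward closed, so the
  indicator is isotonic (\<open>isotonic_on_indicator_Diff_lower_section\<close>). If x is not below
  y, the indicator for z = y is 1 at x but, by reflexivity, 0 at y, so the family recovers the
  preorder.\<close>

lemma lower_semicontinuous_iff:
  "lower_semicontinuous \<tau> f \<longleftrightarrow> (\<forall>a. openin \<tau> {x \<in> topspace \<tau>. a < f x})"
proof -
  have "f -` {a<..} \<inter> topspace \<tau> = {x \<in> topspace \<tau>. a < f x}" for a
    by auto
  \<comment> \<open>Settles the side condition of \<open>continuous_on_generated_topo_iff\<close>
    that the image of f lies in the union of the subbase.\<close>
  moreover have "\<Union> (range greaterThan) = (UNIV :: real set)"
    using lt_ex by auto
  moreover have "(\<forall>U. U \<in> range greaterThan \<longrightarrow> P U) \<longleftrightarrow> (\<forall>a::real. P {a<..})" for P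
    by blast
  ultimately show ?thesis
    by (simp add: lower_semicontinuous_def upper_topology_real continuous_on_generated_topo_iff)
qed

lemma lower_semicontinuous_indicator:
  assumes "openin \<tau> S"
  shows "lower_semicontinuous \<tau> (indicator S)"
  unfolding lower_semicontinuous_iff
proof
  fix a :: real
  have "S \<subseteq> topspace \<tau>"
    using assms by (rule openin_subset)
  \<comment> \<open>An indicator takes only the values 0 and 1, so its strict superlevel sets change
    only at these two thresholds.\<close>
  then have "{x \<in> topspace \<tau>. a < indicator S x} =
      (if a < 0 then topspace \<tau> else if a < 1 then S else {})"
    by (auto simp: indicator_def)
  then show "openin \<tau> {x \<in> topspace \<tau>. a < indicator S x}"
    using assms by simp
qed

lemma openin_upper_topology_Diff_lower_section:
  assumes "x \<in> Y"
  shows "openin (upper_topology Y R) (Y - lower_section Y R x)"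
  unfolding upper_topology_def using assms by (intro topology_generated_by_Basis) auto

text \<open>If x is below y and y is below z, then x is below z; so leaving the lower section of z
  is preserved upwards.\<close>

lemma isotonic_on_indicator_Diff_lower_section:
  assumes "trans R"
  shows "isotonic_on Y R (indicator (Y - lower_section Y R z))"
  using assms by (auto simp: isotonic_on_def lower_section_def indicator_def dest: transD)

theorem mainTheorem2:
  fixes \<tau> :: "'a topology" and R :: "'a rel"
  assumes "topspace \<tau> \<noteq> {}"
    and "preorder_on (topspace \<tau>) R"
    and "\<And>S. openin (upper_topology (topspace \<tau>) R) S \<Longrightarrow> openin \<tau> S"
  shows "\<exists>\<U>. semicontinuous_multi_utility \<tau> R \<U>"
proof
  let ?Y = "topspace \<tau>"
  define u :: "'a \<Rightarrow> 'a \<Rightarrow> real" where "u z = indicator (?Y - lower_section ?Y R z)" for z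
  have R: "refl_on ?Y R" "trans R"
    using assms(2) by (auto simp: preorder_on_def)
  have iso: "isotonic_on ?Y R (u z)" for z
    unfolding u_def using R(2) by (rule isotonic_on_indicator_Diff_lower_section)
  have lsc: "lower_semicontinuous \<tau> (u z)" if "z \<in> ?Y" for z
    unfolding u_def using that
    by (intro lower_semicontinuous_indicator assms(3) openin_upper_topology_Diff_lower_section)
  \<comment> \<open>The single utility indexed by y suffices: reflexivity gives
    \<open>u y y = 0\<close>, which forces \<open>u y x = 0\<close>, so x lies in the lower section
    of y.\<close>
  have sep: "(x, y) \<in> R" if "x \<in> ?Y" "y \<in> ?Y" "u y x \<le> u y y" for x y
    using that R(1)
    by (auto simp: u_def lower_section_def indicator_def dest: refl_onD split: if_splits)
  show "semicontinuous_multi_utility \<tau> R (u ` ?Y)"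
    unfolding semicontinuous_multi_utility_def
    using iso lsc sep by (auto simp: isotonic_on_def)
qed

end
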